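(* Let $k$ be a positive integer and let $D$ be a $3$-partite tournament with $\delta^{+}(D)\geq 2k-1$. Then $D$ contains $k$ vertex-disjoint cycles.
   Context: Digraphs are finite and have no loops or parallel arcs. An orientation of an undirected graph $G$ is a digraph obtained by replacing each edge $\{x,y\}$ of $G$ with exactly one of the arcs $xy$ or $yx$. A $3$-partite tournament is an orientation of a complete multipartite graph with exactly 3 (nonempty) partite sets. All cycles are directed cycles. $\delta^+(D)$ denotes the minimum out-degree of a vertex of $D$. *)

theory Defs
  imports "Graph_Theory.Graph_Theory" "HOL-Library.Disjoint_Sets"
begin

text \<open>
  As in \<^theory>\<open>Graph_Theory.Digraph\<close>, a finite simple undirected graph is a
  symmetric digraph (\<^locale>\<open>graph\<close>): the edge joining \<open>x\<close> and \<open>y\<close> is the pair of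
  opposite arcs \<open>(x, y)\<close>, \<open>(y, x)\<close>.  The locale \<^locale>\<open>digraph\<close> requires
  finiteness and excludes loops and parallel arcs.
\<close>

definition complete_multipartite :: "'a set set \<Rightarrow> ('a, 'c) pre_digraph \<Rightarrow> bool" where
  "complete_multipartite P G \<longleftrightarrow>
     graph G \<and> partition_on (verts G) P \<and>
     arcs_ends G = {(x, y). x \<in> verts G \<and> y \<in> verts G \<and> \<not> (\<exists>A\<in>P. x \<in> A \<and> y \<in> A)}"

definition orientation_of :: "('a, 'b) pre_digraph \<Rightarrow> ('a, 'c) pre_digraph \<Rightarrow> bool" where
  "orientation_of D G \<longleftrightarrow>
     digraph D \<and> graph G \<and> verts D = verts G \<and> arcs_ends D \<subseteq> arcs_ends G \<and>
     (\<forall>(x, y)\<in>arcs_ends G. ((x, y) \<in> arcs_ends D) \<noteq> ((y, x) \<in> arcs_ends D))"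

text \<open>
  The parts of a \<^const>\<open>partition_on\<close> are nonempty.  Taking the arcs of the underlying
  graph to be vertex pairs loses no generality, as it has no parallel arcs.
\<close>

definition multipartite_tournament :: "nat \<Rightarrow> ('a, 'b) pre_digraph \<Rightarrow> bool" where
  "multipartite_tournament n D \<longleftrightarrow>
     (\<exists>(G :: ('a, 'a \<times> 'a) pre_digraph) P.
        complete_multipartite P G \<and> finite P \<and> card P = n \<and> orientation_of D G)"

text \<open>Only meaningful for finite digraphs with at least one vertex.\<close>

definition min_out_degree :: "('a, 'b) pre_digraph \<Rightarrow> nat" where
  "min_out_degree D = Min (out_degree D ` verts D)"

text \<open>
  A \<^const>\<open>pre_digraph.cycle\<close> is a nonempty list of arcs, so its first arc determines
  the start vertex that \<^const>\<open>pre_digraph.awalk_verts\<close> expects.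
\<close>

definition cycle_verts :: "('a, 'b) pre_digraph \<Rightarrow> 'b awalk \<Rightarrow> 'a set" where
  "cycle_verts D p = set (pre_digraph.awalk_verts D (tail D (hd p)) p)"

definition has_disjoint_cycles :: "nat \<Rightarrow> ('a, 'b) pre_digraph \<Rightarrow> bool" where
  "has_disjoint_cycles k D \<longleftrightarrow>
     (\<exists>C. finite C \<and> card C = k \<and> (\<forall>p\<in>C. pre_digraph.cycle D p) \<and>
          disjoint_family_on (cycle_verts D) C)"

end

theory Submission
  imports Defs
begin

text \<open>
  The proof removes short cycles one at a time.  It suffices to find a cycle \<open>C\<close>, inside a set
  \<open>S\<close> of vertices that no arc leaves, such that every vertex of \<open>S\<close> has at most two
  out-neighbours in \<open>C\<close>: then every vertex of \<open>S - C\<close> keeps all but two of its out-neighbours,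
  so the bound \<open>2 * k - 1\<close> drops to \<open>2 * (k - 1) - 1\<close>, and induction on \<open>k\<close> applies to \<open>S - C\<close>.
  For the induction to run, \<open>S - C\<close> may meet fewer than three parts, so the parts are
  treated as at most three colours.

  A triangle meets each of the three colours once.  Every vertex shares its colour with one of the
  three corners and so has at most two out-neighbours on the triangle; here \<open>S\<close> is the whole
  vertex set.  If there is no triangle, let \<open>S\<close> be a terminal strong component.
  By the argument behind Bondy's theorem on strong multipartite tournaments
  (\<open>triangle_of_tricoloured_walk\<close>), two consecutive arcs in \<open>S\<close> return to the colour they
  started from, as otherwise a closed walk through three colours could be shortened to a
  triangle.  So \<open>S\<close> behaves like a strong bipartite tournament: it contains a 4-cycle
  (\<open>four_cycle_of_alternating\<close>), and the out-neighbours of a vertex on a 4-cycle are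
  contained in a pair of opposite corners.
\<close>

section \<open>Properly coloured tournaments\<close>

definition short_cycle :: "'a rel \<Rightarrow> 'a set \<Rightarrow> bool" where
  "short_cycle R C \<longleftrightarrow>
     (\<exists>x y z. C = {x, y, z} \<and> (x, y) \<in> R \<and> (y, z) \<in> R \<and> (z, x) \<in> R) \<or>
     (\<exists>x y z w. C = {x, y, z, w} \<and> x \<noteq> z \<and> y \<noteq> w \<and>
        (x, y) \<in> R \<and> (y, z) \<in> R \<and> (z, w) \<in> R \<and> (w, x) \<in> R)"

lemma short_cycle_mono: "short_cycle R C \<Longrightarrow> R \<subseteq> R' \<Longrightarrow> short_cycle R' C"
  unfolding short_cycle_def by blast

lemma short_cycle_subset: "short_cycle R C \<Longrightarrow> R \<subseteq> V \<times> V \<Longrightarrow> C \<subseteq> V"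
  unfolding short_cycle_def by blast

lemma short_cycle_nonempty: "short_cycle R C \<Longrightarrow> C \<noteq> {}"
  unfolding short_cycle_def by blast

lemma relpow_first_step:
  assumes "(x, z) \<in> R ^^ n" "n \<noteq> 0"
  obtains m y where "n = Suc m" "(x, y) \<in> R" "(y, z) \<in> R ^^ m"
  using assms by (metis not0_implies_Suc relpow_Suc_D2)

locale coloured_tournament =
  fixes V :: "'a set" and R :: "'a rel" and c :: "'a \<Rightarrow> 'c"
  assumes finite_V: "finite V"
    and arcs_V: "R \<subseteq> V \<times> V"
    and asym: "(x, y) \<in> R \<Longrightarrow> (y, x) \<notin> R"
    and proper: "(x, y) \<in> R \<Longrightarrow> c x \<noteq> c y"
    and adjacent: "x \<in> V \<Longrightarrow> y \<in> V \<Longrightarrow> c x \<noteq> c y \<Longrightarrow> (x, y) \<in> R \<or> (y, x) \<in> R"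
begin

lemma restrict:
  assumes "W \<subseteq> V"
  shows "coloured_tournament W (R \<inter> W \<times> W) c"
proof
  show "(x, y) \<in> R \<inter> W \<times> W \<or> (y, x) \<in> R \<inter> W \<times> W"
    if "x \<in> W" "y \<in> W" "c x \<noteq> c y" for x y
    using that assms adjacent by blast
qed (use assms finite_V asym proper in \<open>auto dest: finite_subset\<close>)

text \<open>
  A closed walk with three colours among its vertices passes through three consecutive vertices
  \<open>x\<close>, \<open>y\<close>, \<open>z\<close> of distinct colours; the arc between \<open>x\<close> and \<open>z\<close> either closes a triangle or
  is a shortcut.  The point is to shorten the walk while keeping such a triple: if the successor
  \<open>w\<close> of \<open>z\<close> does not have the colour of \<open>x\<close>, then \<open>x\<close>, \<open>z\<close>, \<open>w\<close> is such a triple.  If it does,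
  then skipping either \<open>y\<close> or \<open>z\<close> leaves one, depending on the vertex after \<open>w\<close>.
\<close>

lemma triangle_of_tricoloured_walk:
  assumes "(x, y) \<in> R" "(y, z) \<in> R" "c x \<noteq> c z" "(z, x) \<in> R ^^ n"
  shows "\<exists>u v w. (u, v) \<in> R \<and> (v, w) \<in> R \<and> (w, u) \<in> R"
  using assms
proof (induction n arbitrary: x y z)
  case 0
  then show ?case by simp
next
  case (Suc n)
  obtain w where w: "(z, w) \<in> R" "(w, x) \<in> R ^^ n"
    using Suc.prems(4) by (meson relpow_Suc_D2)
  show ?case
  proof (cases "(z, x) \<in> R")
    case True
    then show ?thesis using Suc.prems by blast
  next
    case False
    have xz: "(x, z) \<in> R"
      using False adjacent[of x z] Suc.prems arcs_V by blast
    show ?thesis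
    proof (cases "c w = c x")
      case True
      have "n \<noteq> 0" using w False by (cases n) auto
      then obtain m w' where m: "n = Suc m" and w': "(w, w') \<in> R" "(w', x) \<in> R ^^ m"
        by (rule relpow_first_step[OF w(2)])
      show ?thesis
      proof (cases "(w, y) \<in> R")
        case True
        then show ?thesis using Suc.prems w by blast
      next
        case False
        have "c y \<noteq> c w" using True proper[OF Suc.prems(1)] by simp
        then have yw: "(y, w) \<in> R"
          using False adjacent[of y w] Suc.prems w(1) arcs_V by blast
        show ?thesis
        proof (cases "c w' = c z")
          case True
          have "(w', y) \<in> R ^^ n" using w'(2) Suc.prems(1) m by auto
          moreover have "c y \<noteq> c w'" using True proper[OF Suc.prems(2)] by simp
          ultimately show ?thesis using Suc.IH yw w'(1) by blast
        next
          case False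
          have "(w', z) \<in> R ^^ n" using w'(2) xz m by auto
          then show ?thesis using Suc.IH w(1) w'(1) False by metis
        qed
      qed
    next
      case False
      then show ?thesis using Suc.IH xz w by metis
    qed
  qed
qed

text \<open>
  In a region where two consecutive arcs return to the same colour, the endpoints of a walk of
  length three are adjacent, so the walk either closes to a 4-cycle or can be replaced by a
  single arc.  Repeated replacement would turn a closed walk into a pair of opposite arcs.
\<close>

lemma four_cycle_of_alternating:
  assumes alternating: "\<And>u v w. u \<in> S \<Longrightarrow> (u, v) \<in> R \<Longrightarrow> (v, w) \<in> R \<Longrightarrow> c u = c w"
    and closed: "R `` S \<subseteq> S"
    and "y \<in> S" "(y, z) \<in> R" "(z, y) \<in> R ^^ n"
  shows "\<exists>u\<in>S. \<exists>v\<in>S. \<exists>w\<in>S. \<exists>t\<in>S. u \<noteq> w \<and> v \<noteq> t \<and>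
    (u, v) \<in> R \<and> (v, w) \<in> R \<and> (w, t) \<in> R \<and> (t, u) \<in> R"
  using assms(4,5)
proof (induction n arbitrary: z rule: less_induct)
  case (less n)
  have zS: "z \<in> S" using less.prems(1) \<open>y \<in> S\<close> closed by blast
  have "n \<noteq> 0" using less.prems proper by (cases n) auto
  then obtain n1 w1 where 1: "n = Suc n1" "(z, w1) \<in> R" "(w1, y) \<in> R ^^ n1"
    by (rule relpow_first_step[OF less.prems(2)])
  have "n1 \<noteq> 0" using 1 less.prems asym by (cases n1) auto
  then obtain n2 w2 where 2: "n1 = Suc n2" "(w1, w2) \<in> R" "(w2, y) \<in> R ^^ n2"
    by (rule relpow_first_step[OF 1(3)])
  have "n2 \<noteq> 0"
    using 1 2 less.prems proper[of w1 y] alternating[of y z w1] \<open>y \<in> S\<close> by (cases n2) auto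
  then obtain n3 w3 where 3: "n2 = Suc n3" "(w2, w3) \<in> R" "(w3, y) \<in> R ^^ n3"
    by (rule relpow_first_step[OF 2(3)])
  have S: "w1 \<in> S" "w2 \<in> S" "w3 \<in> S" using zS 1 2 3 closed by blast+
  have neq: "z \<noteq> w2" "w1 \<noteq> w3" using 1 2 3 asym by blast+
  show ?case
  proof (cases "(w3, z) \<in> R")
    case True
    then show ?thesis using zS S neq 1 2 3 by blast
  next
    case False
    have "c w3 = c w1" using alternating[of w1 w2 w3] S 2 3 by simp
    then have "c z \<noteq> c w3" using proper[OF 1(2)] by simp
    then have zw3: "(z, w3) \<in> R" using False adjacent[of z w3] 1(2) 3(2) arcs_V by blast
    have "c y = c w1" using alternating less.prems 1 \<open>y \<in> S\<close> by blast
    then have "c y \<noteq> c z" using proper[OF 1(2)] by simp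
    have "(z, y) \<in> R ^^ Suc n3" using zw3 3(3) by (rule relpow_Suc_I2)
    then show ?thesis using less.IH[of "Suc n3" z] less.prems(1) 1 2 3 by simp
  qed
qed

lemma exists_terminal_vertex:
  assumes "V \<noteq> {}"
  shows "\<exists>y\<in>V. \<forall>w. (y, w) \<in> R\<^sup>* \<longrightarrow> (w, y) \<in> R\<^sup>*"
proof -
  have sub: "R\<^sup>* `` {w} \<subseteq> V" if "w \<in> V" for w
    using that arcs_V by (auto elim: rtranclE)
  obtain y where y: "y \<in> V" "\<And>w. w \<in> V \<Longrightarrow> card (R\<^sup>* `` {y}) \<le> card (R\<^sup>* `` {w})"
    using assms finite_V ex_min_if_finite[of "(\<lambda>w. card (R\<^sup>* `` {w})) ` V"]
    by (auto simp: not_less)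
  have "(w, y) \<in> R\<^sup>*" if "(y, w) \<in> R\<^sup>*" for w
  proof -
    have "R\<^sup>* `` {w} = R\<^sup>* `` {y}"
    proof (rule card_seteq)
      show "finite (R\<^sup>* `` {y})" using sub[OF y(1)] finite_V finite_subset by blast
      show "R\<^sup>* `` {w} \<subseteq> R\<^sup>* `` {y}" using that by auto
      show "card (R\<^sup>* `` {y}) \<le> card (R\<^sup>* `` {w})" using y sub that by blast
    qed
    then show ?thesis by blast
  qed
  then show ?thesis using y(1) by blast
qed

text \<open>
  Three colours are needed for the triangle only: a vertex of a fourth colour could dominate
  all of its corners.
\<close>

lemma exists_removable_cycle:
  assumes "V \<noteq> {}" "\<And>v. v \<in> V \<Longrightarrow> R `` {v} \<noteq> {}" "card (c ` V) \<le> 3"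
  shows "\<exists>S C. S \<subseteq> V \<and> R `` S \<subseteq> S \<and> C \<subseteq> S \<and> short_cycle R C \<and>
    (\<forall>v\<in>S. card (R `` {v} \<inter> C) \<le> 2)"
proof (cases "\<exists>x y z. (x, y) \<in> R \<and> (y, z) \<in> R \<and> (z, x) \<in> R")
  case True
  then obtain x y z where t: "(x, y) \<in> R" "(y, z) \<in> R" "(z, x) \<in> R" by blast
  have xyz: "x \<in> V" "y \<in> V" "z \<in> V" using t arcs_V by blast+
  have "card {c x, c y, c z} = 3" using t[THEN proper] by auto
  then have colours: "c ` V = {c x, c y, c z}"
    using card_seteq[of "c ` V" "{c x, c y, c z}"] assms(3) finite_V xyz by simp
  have "card (R `` {v} \<inter> {x, y, z}) \<le> 2" if "v \<in> V" for v
  proof -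
    have "c v \<in> {c x, c y, c z}" using that colours by blast
    then have "R `` {v} \<inter> {x, y, z} \<subseteq> {y, z} \<or> R `` {v} \<inter> {x, y, z} \<subseteq> {x, z} \<or>
        R `` {v} \<inter> {x, y, z} \<subseteq> {x, y}"
      using proper by fastforce
    then obtain a b where "R `` {v} \<inter> {x, y, z} \<subseteq> {a, b}" by blast
    then have "card (R `` {v} \<inter> {x, y, z}) \<le> card {a, b}" by (intro card_mono) auto
    also have "\<dots> \<le> 2" by (simp add: card_insert_if)
    finally show ?thesis .
  qed
  moreover have "short_cycle R {x, y, z}" using t unfolding short_cycle_def by blast
  ultimately show ?thesis using xyz arcs_V by (intro exI[of _ V] exI[of _ "{x, y, z}"]) auto
next
  case False
  obtain y where y: "y \<in> V" "\<And>w. (y, w) \<in> R\<^sup>* \<Longrightarrow> (w, y) \<in> R\<^sup>*"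
    using exists_terminal_vertex[OF assms(1)] by blast
  define S where "S = R\<^sup>* `` {y}"
  have "S \<subseteq> V" using y(1) arcs_V unfolding S_def by (auto elim: rtranclE)
  have closed: "R `` S \<subseteq> S" unfolding S_def by (auto intro: rtrancl_into_rtrancl)
  have alternating: "c u = c w" if "u \<in> S" "(u, v) \<in> R" "(v, w) \<in> R" for u v w
  proof (rule ccontr)
    assume neq: "c u \<noteq> c w"
    have "(w, y) \<in> R\<^sup>*" using that closed y(2) unfolding S_def by blast
    then have "(w, u) \<in> R\<^sup>*" using that(1) unfolding S_def by auto
    then obtain n where "(w, u) \<in> R ^^ n" by (meson rtrancl_power)
    then show False using triangle_of_tricoloured_walk[OF that(2,3) neq] False by blast
  qed
  obtain z where z: "(y, z) \<in> R" using assms(2)[OF y(1)] by blast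
  then have "(z, y) \<in> R\<^sup>*" using y(2) by blast
  then obtain n where n: "(z, y) \<in> R ^^ n" by (meson rtrancl_power)
  have "y \<in> S" unfolding S_def by blast
  then obtain u v w t where S: "u \<in> S" "v \<in> S" "w \<in> S" "t \<in> S" and neq: "u \<noteq> w" "v \<noteq> t"
    and q: "(u, v) \<in> R" "(v, w) \<in> R" "(w, t) \<in> R" "(t, u) \<in> R"
    using four_cycle_of_alternating[OF _ closed _ z n] alternating by metis
  have "card (R `` {s} \<inter> {u, v, w, t}) \<le> 2" if "s \<in> S" for s
  proof -
    \<comment> \<open>Out-neighbours \<open>p\<close>, \<open>q\<close> of \<open>s\<close> with an arc \<open>pq\<close> would give \<open>s\<close> and \<open>q\<close> the same colour.\<close>
    have no_arc: "(p, q) \<notin> R" if "(s, p) \<in> R" "(s, q) \<in> R" for p q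
      using alternating[OF \<open>s \<in> S\<close> that(1)] proper[OF that(2)] by blast
    have "R `` {s} \<inter> {u, v, w, t} \<subseteq> {u, w} \<or> R `` {s} \<inter> {u, v, w, t} \<subseteq> {v, t}"
      using q no_arc by blast
    then obtain a b where "R `` {s} \<inter> {u, v, w, t} \<subseteq> {a, b}" by blast
    then have "card (R `` {s} \<inter> {u, v, w, t}) \<le> card {a, b}" by (intro card_mono) auto
    also have "\<dots> \<le> 2" by (simp add: card_insert_if)
    finally show ?thesis .
  qed
  moreover have "short_cycle R {u, v, w, t}" using q neq unfolding short_cycle_def by blast
  ultimately show ?thesis using S \<open>S \<subseteq> V\<close> closed
    by (intro exI[of _ S] exI[of _ "{u, v, w, t}"]) auto
qed

end

section \<open>Removing short cycles one at a time\<close>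

lemma disjoint_short_cycles:
  assumes "coloured_tournament V R c" "card (c ` V) \<le> 3" "V \<noteq> {}"
    and "\<And>v. v \<in> V \<Longrightarrow> card (R `` {v}) \<ge> 2 * k - 1"
  shows "\<exists>F. finite F \<and> card F = k \<and> disjoint F \<and> (\<forall>C\<in>F. short_cycle R C)"
  using assms
proof (induction k arbitrary: V R)
  case 0
  have "finite {} \<and> card {} = 0 \<and> disjoint {} \<and> (\<forall>C\<in>{}. short_cycle R C)" by simp
  then show ?case by blast
next
  case (Suc k)
  interpret coloured_tournament V R c by fact
  have deg: "card (R `` {v}) \<ge> 2 * k + 1" if "v \<in> V" for v
    using Suc.prems(4)[OF that] by simp
  then have "R `` {v} \<noteq> {}" if "v \<in> V" for v using that by fastforce
  then obtain S C where SC: "S \<subseteq> V" "R `` S \<subseteq> S" "C \<subseteq> S" "short_cycle R C"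
    and drop: "\<And>v. v \<in> S \<Longrightarrow> card (R `` {v} \<inter> C) \<le> 2"
    using exists_removable_cycle[OF Suc.prems(3) _ Suc.prems(2)] by metis
  define W where "W = S - C"
  define Q where "Q = R \<inter> W \<times> W"
  have deg_minus: "card (R `` {v} - C) \<ge> 2 * k - 1" if "v \<in> S" for v
  proof -
    have "finite (R `` {v})" using arcs_V finite_V by (auto intro: finite_subset)
    then have "card (R `` {v}) = card (R `` {v} - C) + card (R `` {v} \<inter> C)"
      by (metis card_Int_Diff add.commute)
    then show ?thesis using deg[of v] drop[of v] that SC(1) by auto
  qed
  have F: "\<exists>F. finite F \<and> card F = k \<and> disjoint F \<and> (\<forall>C\<in>F. short_cycle Q C)"
  proof (cases "k = 0")
    case True
    then have "finite {} \<and> card {} = k \<and> disjoint {} \<and> (\<forall>C\<in>{}. short_cycle Q C)" by simp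
    then show ?thesis by blast
  next
    case False
    show ?thesis
    proof (rule Suc.IH)
      show "coloured_tournament W Q c" unfolding Q_def using SC(1) W_def by (intro restrict) auto
      have "card (c ` W) \<le> card (c ` V)"
        using SC(1) W_def finite_V by (intro card_mono) auto
      then show "card (c ` W) \<le> 3" using Suc.prems(2) by simp
      \<comment> \<open>A vertex of the removed cycle still has out-neighbours outside it, and they lie in \<open>S\<close>.\<close>
      obtain v where v: "v \<in> C" using short_cycle_nonempty[OF SC(4)] by blast
      then have "card (R `` {v} - C) > 0" using deg_minus[of v] SC(3) False by auto
      then have "R `` {v} - C \<noteq> {}" by fastforce
      then show "W \<noteq> {}" using v SC unfolding W_def by blast
      fix v assume v: "v \<in> W"
      then have "Q `` {v} = R `` {v} - C" using SC(2) unfolding Q_def W_def by auto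
      then show "card (Q `` {v}) \<ge> 2 * k - 1" using deg_minus[of v] v W_def by simp
    qed
  qed
  then obtain F where F: "finite F" "card F = k" "disjoint F" "\<forall>C\<in>F. short_cycle Q C" by blast
  have avoid: "B \<inter> C = {}" if "B \<in> F" for B
    using that F(4) short_cycle_subset[of Q B W] unfolding Q_def W_def by blast
  have "C \<notin> F" using avoid[of C] short_cycle_nonempty[OF SC(4)] by auto
  then have "card (insert C F) = Suc k" using F by simp
  moreover have "disjoint (insert C F)"
    using F(3) avoid by (auto simp: pairwise_insert disjnt_def)
  moreover have "\<forall>B\<in>insert C F. short_cycle R B"
    using F(4) SC(4) short_cycle_mono[of Q _ R] unfolding Q_def by blast
  ultimately show ?case using F(1) by (intro exI[of _ "insert C F"]) simp
qed

section \<open>From vertex sets to arc cycles\<close>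

lemma (in digraph) cycle_of_short_cycle:
  assumes "short_cycle (arcs_ends G) C"
  shows "\<exists>p. cycle p \<and> cycle_verts G p = C"
proof -
  have arc: "\<exists>e. e \<in> arcs G \<and> tail G e = x \<and> head G e = y" if "(x, y) \<in> arcs_ends G" for x y
    using that by (auto simp: arcs_ends_def arc_to_ends_def)
  have irrefl: "(x, x) \<notin> arcs_ends G" for x
    using adj_not_same by blast
  consider (3) x y z where "C = {x, y, z}" "(x, y) \<in> arcs_ends G" "(y, z) \<in> arcs_ends G"
      "(z, x) \<in> arcs_ends G"
    | (4) x y z w where "C = {x, y, z, w}" "x \<noteq> z" "y \<noteq> w" "(x, y) \<in> arcs_ends G"
      "(y, z) \<in> arcs_ends G" "(z, w) \<in> arcs_ends G" "(w, x) \<in> arcs_ends G"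
    using assms unfolding short_cycle_def by blast
  then show ?thesis
  proof cases
    case 3
    obtain a b d where e: "a \<in> arcs G" "tail G a = x" "head G a = y"
      "b \<in> arcs G" "tail G b = y" "head G b = z" "d \<in> arcs G" "tail G d = z" "head G d = x"
      using 3 arc by metis
    have "x \<noteq> y" "y \<noteq> z" "z \<noteq> x" using 3 irrefl by blast+
    then have "awalk x [a, b, d] x" "distinct (tl (awalk_verts x [a, b, d]))"
      using e by (auto simp: awalk_def)
    then have "cycle [a, b, d]" unfolding cycle_def by blast
    moreover have "cycle_verts G [a, b, d] = C"
      using 3 e unfolding cycle_verts_def by auto
    ultimately show ?thesis by blast
  next
    case 4
    obtain a b d f where e: "a \<in> arcs G" "tail G a = x" "head G a = y"
      "b \<in> arcs G" "tail G b = y" "head G b = z" "d \<in> arcs G" "tail G d = z" "head G d = w"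
      "f \<in> arcs G" "tail G f = w" "head G f = x"
      using 4 arc by metis
    have "x \<noteq> y" "y \<noteq> z" "z \<noteq> w" "w \<noteq> x" using 4 irrefl by blast+
    then have "awalk x [a, b, d, f] x" "distinct (tl (awalk_verts x [a, b, d, f]))"
      using e 4(2,3) by (auto simp: awalk_def)
    then have "cycle [a, b, d, f]" unfolding cycle_def by blast
    moreover have "cycle_verts G [a, b, d, f] = C"
      using 4 e unfolding cycle_verts_def by auto
    ultimately show ?thesis by blast
  qed
qed

lemma (in digraph) has_disjoint_cycles_of_short_cycles:
  assumes "finite F" "disjoint F" "\<forall>C\<in>F. short_cycle (arcs_ends G) C"
  shows "has_disjoint_cycles (card F) G"
proof -
  obtain p where p: "\<And>C. C \<in> F \<Longrightarrow> cycle (p C)" "\<And>C. C \<in> F \<Longrightarrow> cycle_verts G (p C) = C"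
    using cycle_of_short_cycle assms(3) by metis
  have inj: "inj_on p F" using p(2) by (metis inj_onI)
  have "disjoint_family_on (cycle_verts G) (p ` F)"
    using assms(2) p(2) unfolding disjoint_family_on_def disjoint_def by (metis imageE)
  then show ?thesis unfolding has_disjoint_cycles_def
    using assms(1) p(1) inj by (intro exI[of _ "p ` F"]) (auto simp: card_image)
qed

lemma (in digraph) out_degree_eq_card_Image: "out_degree G v = card (arcs_ends G `` {v})"
proof -
  have "arcs_ends G `` {v} = head G ` out_arcs G v"
    by (force simp: arcs_ends_def arc_to_ends_def)
  moreover have "inj_on (head G) (out_arcs G v)"
    using no_multi_arcs by (intro inj_onI) (auto simp: arc_to_ends_def)
  ultimately show ?thesis unfolding out_degree_def by (simp add: card_image)
qed

lemma multipartite_tournament_colouring: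
  fixes D :: "('a, 'b) pre_digraph"
  assumes "multipartite_tournament n D"
  shows "digraph D \<and> (\<exists>c :: 'a \<Rightarrow> 'a set.
    coloured_tournament (verts D) (arcs_ends D) c \<and> card (c ` verts D) = n)"
proof -
  obtain G :: "('a, 'a \<times> 'a) pre_digraph" and P
    where P: "partition_on (verts G) P" "finite P" "card P = n"
      and G: "arcs_ends G = {(x, y). x \<in> verts G \<and> y \<in> verts G \<and> \<not> (\<exists>A\<in>P. x \<in> A \<and> y \<in> A)}"
      and D: "digraph D" "verts D = verts G" "arcs_ends D \<subseteq> arcs_ends G"
      and one: "\<And>x y. (x, y) \<in> arcs_ends G \<Longrightarrow>
        ((x, y) \<in> arcs_ends D) \<noteq> ((y, x) \<in> arcs_ends D)"
  proof -
    obtain G :: "('a, 'a \<times> 'a) pre_digraph" and P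
      where "complete_multipartite P G" "finite P" "card P = n" "orientation_of D G"
      using assms unfolding multipartite_tournament_def by blast
    then show ?thesis
      unfolding complete_multipartite_def orientation_of_def by (intro that[of G P]) auto
  qed
  interpret digraph D by fact
  define c where "c v = (THE A. A \<in> P \<and> v \<in> A)" for v
  have c_eq: "c v = A" if "A \<in> P" "v \<in> A" for v A
    unfolding c_def using that partition_onD2[OF P(1)]
    by (intro the_equality) (auto simp: pairwise_def disjnt_def)
  have c_in: "c v \<in> P \<and> v \<in> c v" if "v \<in> verts G" for v
    using that partition_onD1[OF P(1)] c_eq by auto
  have edge: "(x, y) \<in> arcs_ends G \<longleftrightarrow> x \<in> verts G \<and> y \<in> verts G \<and> c x \<noteq> c y" for x y
  proof -
    have "(\<exists>A\<in>P. x \<in> A \<and> y \<in> A) \<longleftrightarrow> c x = c y" if "x \<in> verts G" "y \<in> verts G"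
      using c_in[OF that(1)] c_in[OF that(2)] c_eq by metis
    then show ?thesis unfolding G by blast
  qed
  have "c ` verts G = P"
  proof
    show "c ` verts G \<subseteq> P" using c_in by blast
    show "P \<subseteq> c ` verts G"
    proof
      fix A assume A: "A \<in> P"
      then have "A \<noteq> {}" using partition_onD3[OF P(1)] by blast
      then obtain v where "v \<in> A" by blast
      then show "A \<in> c ` verts G" using A c_eq[of A v] partition_onD1[OF P(1)] by blast
    qed
  qed
  moreover have "coloured_tournament (verts D) (arcs_ends D) c"
  proof
    show "finite (verts D)" by simp
    show "arcs_ends D \<subseteq> verts D \<times> verts D" using D(2,3) edge by force
    show "(y, x) \<notin> arcs_ends D" if "(x, y) \<in> arcs_ends D" for x y
      using that one D(3) by blast
    show "c x \<noteq> c y" if "(x, y) \<in> arcs_ends D" for x y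
      using that D(3) edge by blast
    show "(x, y) \<in> arcs_ends D \<or> (y, x) \<in> arcs_ends D"
      if "x \<in> verts D" "y \<in> verts D" "c x \<noteq> c y" for x y
      using that one edge D(2) by blast
  qed
  ultimately show ?thesis using D(1,2) P(3) by auto
qed

section \<open>Disjoint cycles in 3-partite tournaments\<close>

theorem theorem2p3:
  fixes D :: "('a, 'b) pre_digraph" and k :: nat
  assumes "k \<ge> 1"
    and "multipartite_tournament 3 D"
    and "min_out_degree D \<ge> 2 * k - 1"
  shows "has_disjoint_cycles k D"
proof -
  obtain c :: "'a \<Rightarrow> 'a set" where D: "digraph D"
    and c: "coloured_tournament (verts D) (arcs_ends D) c" "card (c ` verts D) = 3"
    using multipartite_tournament_colouring[OF assms(2)] by blast
  interpret digraph D by fact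
  have "verts D \<noteq> {}" using c(2) by auto
  moreover have "card (arcs_ends D `` {v}) \<ge> 2 * k - 1" if "v \<in> verts D" for v
  proof -
    have "min_out_degree D \<le> out_degree D v"
      unfolding min_out_degree_def using that by (intro Min_le) auto
    then show ?thesis using assms(3) out_degree_eq_card_Image by simp
  qed
  ultimately obtain F where "finite F" "card F = k" "disjoint F"
      "\<forall>C\<in>F. short_cycle (arcs_ends D) C"
    using disjoint_short_cycles[OF c(1), of k] c(2) by auto
  then show ?thesis using has_disjoint_cycles_of_short_cycles by blast
qed

end
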